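(* If $n=pqr$, where $p < q < r$ are primes, then $[\overline{pr}] \cup [\overline{qr}]$ is a minimum separating set of $\widetilde{\mathcal{G}}(\mathbb{Z}_n)$. Consequently, $$\kappa(\mathcal{G}(\mathbb{Z}_n)) = \phi(n)+p+q-1.$$
   Context: $\phi$ is Euler's phi function. $\mathbb{Z}_n$ is the additive group of integers modulo $n$, and $\overline{a}$ is the residue class of $a$. The power graph $\mathcal{G}(\mathbb{Z}_n)$ is the simple undirected graph with vertex set $\mathbb{Z}_n$ in which two distinct vertices are adjacent if one is a positive integer multiple of the other. For $x\in\mathbb{Z}_n$, $[x]=\{y\in\mathbb{Z}_n : \langle y\rangle=\langle x\rangle\}$, where $\langle x\rangle$ is the cyclic subgroup generated by $x$. Let $\mathcal{S}(\mathbb{Z}_n)=\{\overline{a} : 1\le a<n,\ \gcd(a,n)=1\}\cup\{\overline{0}\}$, and let $\widetilde{\mathcal{G}}(\mathbb{Z}_n)$ be the graph obtained from $\mathcal{G}(\mathbb{Z}_n)$ by deleting all vertices in $\mathcal{S}(\mathbb{Z}_n)$. The vertex connectivity $\kappa(\Gamma)$ of a graph $\Gamma$ is the minimum number of vertices whose removal results in a disconnected graph or a trivial graph (one vertex, no edges). A separating set of $\Gamma$ is a set of vertices whose removal increases the number of components of $\Gamma$; a minimum separating set is a separating set of least cardinality. *)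

theory Defs
  imports
    "HOL-Algebra.Elementary_Groups"
    "HOL-Number_Theory.Totient"
    "Graph_Theory.Digraph_Component"
begin

section \<open>Vertex deletion, separating sets and vertex connectivity\<close>

text \<open>
  Undirected simple graphs are represented, as in Graph_Theory, by symmetric loop-free digraphs
  without parallel arcs. The strongly connected components of such a digraph are the connected
  components of the undirected graph.
  All notions below are meant for finite graphs.
\<close>

definition delete_verts :: "('a, 'b) pre_digraph \<Rightarrow> 'a set \<Rightarrow> ('a, 'b) pre_digraph" where
  "delete_verts G X = G \<restriction> (verts G - X)"

definition num_components :: "('a, 'b) pre_digraph \<Rightarrow> nat" where
  "num_components G = card (pre_digraph.sccs G)"

definition separating_set :: "('a, 'b) pre_digraph \<Rightarrow> 'a set \<Rightarrow> bool" where
  "separating_set G X \<longleftrightarrow>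
     X \<subseteq> verts G \<and> num_components (delete_verts G X) > num_components G"

definition minimum_separating_set :: "('a, 'b) pre_digraph \<Rightarrow> 'a set \<Rightarrow> bool" where
  "minimum_separating_set G X \<longleftrightarrow>
     separating_set G X \<and> (\<forall>Y. separating_set G Y \<longrightarrow> card X \<le> card Y)"

definition trivial_graph :: "('a, 'b) pre_digraph \<Rightarrow> bool" where
  "trivial_graph G \<longleftrightarrow> card (verts G) = 1 \<and> arcs G = {}"

text \<open>
  The graph without vertices is not connected in the sense of Graph_Theory. This does not
  influence the minimum for a nonempty loop-free graph, because removing all vertices but one
  already leaves a trivial graph.
\<close>

definition vertex_connectivity :: "('a, 'b) pre_digraph \<Rightarrow> nat" where
  "vertex_connectivity G =
     (LEAST k. \<exists>X. X \<subseteq> verts G \<and> finite X \<and> card X = k \<and>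
        (\<not> Digraph_Component.connected (delete_verts G X) \<or> trivial_graph (delete_verts G X)))"


section \<open>Power graphs\<close>

text \<open>In additive notation, \<open>x [^] m\<close> is the multiple \<open>m x\<close>.\<close>

definition power_graph :: "('a, 'c) monoid_scheme \<Rightarrow> ('a, 'a \<times> 'a) pre_digraph" where
  "power_graph A = with_proj
     \<lparr> pverts = carrier A,
       parcs = {(x, y). x \<in> carrier A \<and> y \<in> carrier A \<and> x \<noteq> y \<and>
                  (\<exists>m::nat. m > 0 \<and> (y = x [^]\<^bsub>A\<^esub> m \<or> x = y [^]\<^bsub>A\<^esub> m))} \<rparr>"

lemma graph_power_graph:
  assumes "finite (carrier A)"
  shows "graph (power_graph A)"
proof -
  have "finite (arcs (power_graph A))"
    by (rule finite_subset[of _ "carrier A \<times> carrier A"])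
      (use assms in \<open>auto simp: power_graph_def\<close>)
  then show ?thesis
    using assms
    by unfold_locales
      (auto simp: power_graph_def symmetric_def sym_def arc_to_ends_def)
qed

definition generator_class :: "('a, 'c) monoid_scheme \<Rightarrow> 'a \<Rightarrow> 'a set" where
  "generator_class A x = {y \<in> carrier A. generate A {y} = generate A {x}}"


section \<open>The reduced power graph of the integers modulo n\<close>

text \<open>The carrier of \<open>integer_mod_group n\<close> consists of the representatives \<open>0, \<dots>, n - 1\<close>.\<close>

definition res_class :: "nat \<Rightarrow> nat \<Rightarrow> int" where
  "res_class n a = int a mod int n"

definition gens_and_zero :: "nat \<Rightarrow> int set" where
  "gens_and_zero n = {res_class n a | a. 1 \<le> a \<and> a < n \<and> gcd a n = 1} \<union> {res_class n 0}"

definition reduced_power_graph :: "nat \<Rightarrow> (int, int \<times> int) pre_digraph" where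
  "reduced_power_graph n = delete_verts (power_graph (integer_mod_group n)) (gens_and_zero n)"

end

theory Submission
  imports Defs
begin

text \<open>
  In \<open>\<int>\<^sub>n\<close> the positive multiples of \<open>x\<close> are the residues divisible by \<open>gcd x n\<close>, so the power graph
  depends on the greatest common divisors alone: distinct \<open>x\<close> and \<open>y\<close> are adjacent iff one of
  \<open>gcd x n\<close> and \<open>gcd y n\<close> divides the other, and \<open>[x]\<close> is the set of all \<open>y\<close> with
  \<open>gcd y n = gcd x n\<close>. This set is a clique of \<open>\<phi>(n / gcd x n)\<close> vertices.

  The reduced graph for \<open>n = p q r\<close> keeps the divisors other than \<open>1\<close> and \<open>n\<close>. Under divisibility
  these form the hexagon \<open>p, p q, q, q r, r, p r\<close>, and the reduced graph arises from it by blowing up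
  each vertex to a clique. As long as at most one clique is deleted completely, one can still walk
  around the hexagon without crossing a gap (\<open>connected_cycle_blowup\<close>). A separating set therefore
  contains two different cliques entirely. The smallest clique is \<open>[q r]\<close> with \<open>p - 1\<close> elements, and all others
  have at least \<open>q - 1\<close> elements, so a separating set has at least \<open>p + q - 2\<close> elements. This
  bound is attained by \<open>[p r] \<union> [q r]\<close>: these are the two neighbours of \<open>[r]\<close> on the hexagon, so that
  their removal isolates \<open>[r]\<close> from the rest.

  For the full power graph, the \<open>\<phi>(n)\<close> generators and \<open>0\<close> are adjacent to every other vertex. Hence
  a vertex set whose removal disconnects the graph contains all of them, and its remaining elements
  disconnect the reduced graph; this adds \<open>\<phi>(n) + 1\<close> to the bound \<open>p + q - 2\<close>. Leaving a trivial
  graph costs \<open>n - 1\<close> vertices, which is no cheaper.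
\<close>

section \<open>Components and connectedness after deleting vertices\<close>

lemma verts_delete_verts [simp]: "verts (delete_verts G X) = verts G - X"
  by (simp add: delete_verts_def)

lemma delete_verts_delete_verts:
  "delete_verts (delete_verts G X) Y = delete_verts G (X \<union> Y)"
  by (rule pre_digraph.equality) (auto simp: delete_verts_def)

lemma dominates_delete_verts_iff:
  "u \<rightarrow>\<^bsub>delete_verts G X\<^esub> v \<longleftrightarrow> u \<rightarrow>\<^bsub>G\<^esub> v \<and> {u, v} \<subseteq> verts G - X"
  by (auto simp: delete_verts_def arcs_ends_def arc_to_ends_def)

lemma (in graph) graph_delete_verts: "graph (delete_verts G X)"
proof -
  have "induced_subgraph (delete_verts G X) G"
    unfolding delete_verts_def by (rule induced_induce) auto
  then have "digraph (delete_verts G X)" and "sym_digraph (delete_verts G X)"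
    by (rule digraphI_induced, rule induced_graph_imp_graph)
  then show ?thesis
    by (simp add: digraph.graphI sym_digraph.sym_arcs)
qed

lemma (in sym_digraph) connected_iff_strongly_connected:
  "Digraph_Component.connected G \<longleftrightarrow> strongly_connected G"
  by (simp add: connected_def strongly_connected_def reachable_mk_symmetric_eq[OF sym_arcs])

text \<open>
  The next two lemmas link the number of components, which is what separating sets speak about,
  to connectedness, which can be established by exhibiting walks.
\<close>

lemma (in graph) num_components_connected:
  assumes "Digraph_Component.connected G"
  shows "num_components G = 1"
proof -
  have sc: "strongly_connected G"
    using assms by (simp add: connected_iff_strongly_connected)
  then have "scc_of u = verts G" if "u \<in> verts G" for u
    using that by (auto simp: scc_of_def strongly_connected_def elim: reachable_in_vertsE)
  then have "sccs_verts = {verts G}"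
    using sc by (auto simp: sccs_verts_conv_scc_of strongly_connected_def)
  then show ?thesis
    by (simp add: num_components_def flip: card_sccs_verts)
qed

lemma (in graph) num_components_disconnected:
  assumes "\<not> Digraph_Component.connected G" and "verts G \<noteq> {}"
  shows "num_components G > 1"
proof -
  obtain u v where uv: "u \<in> verts G" "v \<in> verts G" "\<not> u \<rightarrow>\<^sup>* v"
    using assms by (auto simp: connected_iff_strongly_connected strongly_connected_def)
  then have "scc_of u \<noteq> scc_of v"
    using in_scc_of_self[of v] by (auto simp: scc_of_def)
  then have "card {scc_of u, scc_of v} = 2"
    by simp
  \<comment> \<open>Finiteness is essential: infinitely many components would have cardinality 0.\<close>
  moreover have "card {scc_of u, scc_of v} \<le> card sccs_verts"
    using uv by (intro card_mono finite_sccs_verts) (auto intro: scc_of_in_sccs_verts)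
  ultimately show ?thesis
    by (simp add: num_components_def flip: card_sccs_verts)
qed

lemma (in graph) separating_set_iff_disconnected:
  assumes "Digraph_Component.connected G" and "X \<subseteq> verts G" and "verts G - X \<noteq> {}"
  shows "separating_set G X \<longleftrightarrow> \<not> Digraph_Component.connected (delete_verts G X)"
proof -
  interpret D: graph "delete_verts G X"
    by (rule graph_delete_verts)
  show ?thesis
    using assms(2,3) num_components_connected[OF assms(1)]
      D.num_components_connected D.num_components_disconnected
    by (cases "Digraph_Component.connected (delete_verts G X)") (simp_all add: separating_set_def)
qed

lemma (in sym_digraph) connected_dominating_vertex:
  assumes "s \<in> verts G" and "\<And>u. u \<in> verts G \<Longrightarrow> u \<noteq> s \<Longrightarrow> s \<rightarrow> u"
  shows "Digraph_Component.connected G"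
proof -
  have from_s: "s \<rightarrow>\<^sup>* u" if "u \<in> verts G" for u
    using assms that by (cases "u = s") auto
  have to_s: "u \<rightarrow>\<^sup>* s" if "u \<in> verts G" for u
    using from_s[OF that] symmetric_reachable[OF sym_arcs] by simp
  have "strongly_connected G"
    using assms(1) reachable_trans[OF to_s from_s] by (intro strongly_connectedI) auto
  then show ?thesis
    by (simp add: connected_iff_strongly_connected)
qed

lemma (in sym_digraph) disconnected_closed_set:
  assumes "a \<in> A" "a \<in> verts G" "b \<in> verts G" "b \<notin> A"
    and closed: "\<And>u v. u \<in> A \<Longrightarrow> u \<rightarrow> v \<Longrightarrow> v \<in> A"
  shows "\<not> Digraph_Component.connected G"
proof
  assume "Digraph_Component.connected G"
  then have "a \<rightarrow>\<^sup>* b"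
    using symmetric_connected_imp_strongly_connected[OF sym_arcs] assms
    by (auto simp: strongly_connected_def)
  then have "b \<in> A"
    by (induct rule: reachable_induct) (use \<open>a \<in> A\<close> closed in auto)
  then show False
    using \<open>b \<notin> A\<close> by simp
qed

text \<open>
  Blow up a cycle of length \<open>k\<close> by replacing its vertices with cliques \<open>C 0, \<dots>, C (k - 1)\<close>, some of
  which may be empty, and join neighbouring cliques completely. If \<open>C j\<close> is the only clique that
  may be empty, then the walk around the cycle that starts in \<open>C (j + 1)\<close> never has to cross an
  empty clique before it ends in \<open>C (j + k) = C j\<close>, and it passes through every nonempty clique.
  Extending \<open>C\<close> periodically to all indices avoids a case distinction at \<open>k - 1\<close>.
\<close>

lemma (in sym_digraph) connected_cycle_blowup:
  fixes C :: "nat \<Rightarrow> 'a set"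
  assumes "k \<ge> 2"
    and verts: "verts G = (\<Union>i. C i)"
    and period: "\<And>i. C (i + k) = C i"
    and join: "\<And>i u v. u \<in> C i \<Longrightarrow> v \<in> C i \<union> C (Suc i) \<Longrightarrow> u \<noteq> v \<Longrightarrow> u \<rightarrow> v"
    and nonempty: "\<And>i. C i = {} \<Longrightarrow> [i = j] (mod k)"
  shows "Digraph_Component.connected G"
proof -
  have step: "u \<rightarrow>\<^sup>* v" if "u \<in> C i" "v \<in> C i \<union> C (Suc i)" for u v i
    using that join[of u i v] verts by (cases "u = v") auto
  have walk: "x \<rightarrow>\<^sup>* y" if "x \<in> C (j + 1)" "y \<in> C (j + Suc m)" "m < k" for x y m
    using that(2,3)
  proof (induction m arbitrary: y)
    case 0
    then show ?case
      using step[of x "j + 1" y] that(1) by simp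
  next
    case (Suc m)
    have "\<not> [j + Suc m = j] (mod k)"
      using Suc.prems(2) cong_add_lcancel_0_nat[of j "Suc m" k]
      by (auto simp: cong_0_iff dest: dvd_imp_le)
    then obtain z where z: "z \<in> C (j + Suc m)"
      using nonempty by blast
    then have "x \<rightarrow>\<^sup>* z"
      using Suc by simp
    also have "z \<rightarrow>\<^sup>* y"
      using z Suc.prems by (intro step) auto
    finally show ?case .
  qed
  have period': "C (i + t * k) = C i" for i t
  proof (induction t)
    case (Suc t)
    then show ?case
      using period[of "i + t * k"] by (simp add: algebra_simps)
  qed simp
  have mod_k: "C i = C (i mod k)" for i
    using period'[of "i mod k" "i div k"] by (simp add: algebra_simps)
  have in_walk: "\<exists>m<k. y \<in> C (j + Suc m)" if y: "y \<in> verts G" for y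
  proof -
    obtain i where i: "y \<in> C i"
      using y verts by auto
    \<comment> \<open>Modulo \<open>k\<close> this is \<open>i - (j + 1)\<close>; the added multiple of \<open>k\<close> keeps the difference of
      natural numbers from being cut off at zero.\<close>
    define m where "m = (i + (j + 1) * k - (j + 1)) mod k"
    have "(j + 1) * 1 \<le> (j + 1) * k"
      using \<open>k \<ge> 2\<close> by (intro mult_le_mono2) simp
    then have le: "j + 1 \<le> (j + 1) * k"
      by simp
    have "(j + Suc m) mod k = (j + 1 + (i + (j + 1) * k - (j + 1))) mod k"
      unfolding m_def by (metis Suc_eq_plus1 add.commute add_Suc_right mod_add_right_eq)
    also have "\<dots> = i mod k"
      using le by (simp only: le_add_diff_inverse trans_le_add2 mod_mult_self1)
    finally have "C (j + Suc m) = C i"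
      using mod_k[of i] mod_k[of "j + Suc m"] by simp
    then show ?thesis
      using i \<open>k \<ge> 2\<close> by (auto intro!: exI[of _ m] simp: m_def)
  qed
  have "\<not> [j + 1 = j] (mod k)"
    using \<open>k \<ge> 2\<close> cong_add_lcancel_0_nat[of j 1 k] by (auto simp: cong_0_iff)
  then obtain x where x: "x \<in> C (j + 1)"
    using nonempty by blast
  have hub: "x \<rightarrow>\<^sup>* y" if "y \<in> verts G" for y
    using in_walk[OF that] walk[OF x] by blast
  have "strongly_connected G"
  proof
    show "verts G \<noteq> {}"
      using x verts by auto
    show "u \<rightarrow>\<^sup>* v" if "u \<in> verts G" "v \<in> verts G" for u v
      using reachable_trans[OF symmetric_reachable[OF sym_arcs hub] hub] that by simp
  qed
  then show ?thesis
    by (simp add: connected_iff_strongly_connected)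
qed


section \<open>The power graph of a finite cyclic group and greatest common divisors\<close>

definition gcd_class :: "nat \<Rightarrow> nat \<Rightarrow> int set" where
  "gcd_class n d = {x \<in> {0..<int n}. gcd x (int n) = int d}"

lemma finite_gcd_class [simp]: "finite (gcd_class n d)"
  by (rule finite_subset[of _ "{0..<int n}"]) (auto simp: gcd_class_def)

lemma gcd_class_disjoint: "d \<noteq> e \<Longrightarrow> gcd_class n d \<inter> gcd_class n e = {}"
  by (auto simp: gcd_class_def)

lemma gcd_class_eq_image: "gcd_class n d = int ` {k. k < n \<and> gcd k n = d}"
proof
  show "gcd_class n d \<subseteq> int ` {k. k < n \<and> gcd k n = d}"
  proof
    fix x assume x: "x \<in> gcd_class n d"
    then obtain k where "x = int k"
      by (auto simp: gcd_class_def elim: nonneg_int_cases)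
    then show "x \<in> int ` {k. k < n \<and> gcd k n = d}"
      using x by (auto simp: gcd_class_def)
  qed
qed (auto simp: gcd_class_def)

lemma card_gcd_class:
  assumes "n > 0" and "d dvd n"
  shows "card (gcd_class n d) = totient (n div d)"
proof -
  have "bij_betw (\<lambda>k. k mod n) {k \<in> {0<..n}. gcd k n = d} {k. k < n \<and> gcd k n = d}"
    \<comment> \<open>The reduction moves the representative \<open>n\<close> to \<open>0\<close> and fixes all others.\<close>
    by (rule bij_betw_byWitness[where f' = "\<lambda>k. if k = 0 then n else k"])
      (use assms in \<open>auto simp: mod_if\<close>)
  then have "card {k. k < n \<and> gcd k n = d} = totient (n div d)"
    using card_gcd_eq_totient[OF assms] by (simp add: bij_betw_same_card)
  then show ?thesis
    by (simp add: gcd_class_eq_image card_image)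
qed

text \<open>
  Bezout writes every multiple of \<open>gcd x n\<close> as an integer multiple of \<open>x\<close> modulo \<open>n\<close>. The
  coefficient matters only modulo \<open>n\<close>, hence it can be chosen positive, as the edges of the power
  graph demand.
\<close>

lemma positive_multiple_iff_gcd_dvd:
  fixes x y :: int
  assumes "n > 0" and "y \<in> {0..<int n}"
  shows "(\<exists>m::nat. m > 0 \<and> y = (int m * x) mod int n) \<longleftrightarrow> gcd x (int n) dvd y"
proof
  assume "\<exists>m::nat. m > 0 \<and> y = (int m * x) mod int n"
  then show "gcd x (int n) dvd y"
    by (auto intro: dvd_mod)
next
  assume "gcd x (int n) dvd y"
  then obtain c where c: "y = gcd x (int n) * c"
    by blast
  obtain u v where uv: "u * x + v * int n = gcd x (int n)"
    using bezout_int by blast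
  define m where "m = nat ((u * c) mod int n) + n"
  have "int m * x mod int n = (int m mod int n) * x mod int n"
    by (simp add: mod_mult_left_eq)
  also have "int m mod int n = u * c mod int n"
    using assms by (simp add: m_def)
  also have "(u * c mod int n) * x mod int n = (u * x * c + int n * (v * c)) mod int n"
    unfolding mod_mult_left_eq mod_mult_self2 by (simp add: ac_simps)
  also have "u * x * c + int n * (v * c) = y"
    unfolding c uv[symmetric] by (simp add: algebra_simps)
  also have "y mod int n = y"
    using assms by simp
  finally show "\<exists>m::nat. m > 0 \<and> y = (int m * x) mod int n"
    using assms by (intro exI[of _ m]) (simp add: m_def)
qed

lemma mem_generate_iff_gcd_dvd:
  assumes "n > 0" and "x \<in> {0..<int n}"
  shows "y \<in> generate (integer_mod_group n) {x} \<longleftrightarrow> y \<in> {0..<int n} \<and> gcd x (int n) dvd y"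
proof -
  interpret group "integer_mod_group n"
    by simp
  have carrier: "carrier (integer_mod_group n) = {0..<int n}"
    using assms by (simp add: carrier_integer_mod_group)
  have gen: "generate (integer_mod_group n) {x} = range (\<lambda>k. (k * x) mod int n)"
    using generate_pow[of x] assms by (auto simp: carrier int_pow_integer_mod_group)
  show ?thesis
  proof
    assume "y \<in> generate (integer_mod_group n) {x}"
    then show "y \<in> {0..<int n} \<and> gcd x (int n) dvd y"
      using assms by (auto simp: gen intro: dvd_mod)
  next
    assume "y \<in> {0..<int n} \<and> gcd x (int n) dvd y"
    then show "y \<in> generate (integer_mod_group n) {x}"
      unfolding gen using positive_multiple_iff_gcd_dvd[of n y x] assms by auto
  qed
qed

lemma generator_class_eq_gcd_class:
  assumes "d dvd n" "d < n"
  shows "generator_class (integer_mod_group n) (res_class n d) = gcd_class n d"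
proof -
  have n: "n > 0"
    using assms by simp
  have res: "res_class n d = int d"
    using assms by (simp add: res_class_def)
  have gcd_d: "gcd (int d) (int n) = int d"
    using assms by (simp add: gcd_int_def gcd_nat.absorb1)
  \<comment> \<open>Equal subgroups contain the same multiples, in particular each other's generator.\<close>
  have "generate (integer_mod_group n) {y} = generate (integer_mod_group n) {int d}
      \<longleftrightarrow> gcd y (int n) = int d" if y: "y \<in> {0..<int n}" for y
  proof
    have d: "int d \<in> {0..<int n}"
      using assms by simp
    assume "generate (integer_mod_group n) {y} = generate (integer_mod_group n) {int d}"
    then have "z \<in> {0..<int n} \<Longrightarrow> gcd y (int n) dvd z \<longleftrightarrow> int d dvd z" for z
      using mem_generate_iff_gcd_dvd[OF n y, of z] mem_generate_iff_gcd_dvd[OF n d, of z] gcd_d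
      by auto
    from this[OF y] this[OF d] have "gcd y (int n) dvd int d" "int d dvd gcd y (int n)"
      using assms by (auto simp: int_dvd_int_iff)
    then show "gcd y (int n) = int d"
      by (simp add: zdvd_antisym_nonneg)
  next
    assume "gcd y (int n) = int d"
    then show "generate (integer_mod_group n) {y} = generate (integer_mod_group n) {int d}"
      using y n assms gcd_d by (auto simp: mem_generate_iff_gcd_dvd)
  qed
  then show ?thesis
    using n by (auto simp: generator_class_def res gcd_class_def carrier_integer_mod_group)
qed

lemma gens_and_zero_eq_gcd_classes:
  assumes "n > 1"
  shows "gens_and_zero n = gcd_class n 1 \<union> gcd_class n n"
proof -
  have "{res_class n a | a. 1 \<le> a \<and> a < n \<and> gcd a n = 1} = int ` {a. 1 \<le> a \<and> a < n \<and> gcd a n = 1}"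
    by (auto simp: res_class_def image_iff) (metis mod_less zmod_int)
  also have "{a. 1 \<le> a \<and> a < n \<and> gcd a n = 1} = {a. a < n \<and> gcd a n = 1}"
    using assms by (auto simp: Suc_le_eq intro: gr0I)
  finally have gens: "{res_class n a | a. 1 \<le> a \<and> a < n \<and> gcd a n = 1} = gcd_class n 1"
    by (simp add: gcd_class_eq_image)
  have "a = 0" if "a < n" "gcd a n = n" for a
    using that dvd_imp_le[of n a] by (metis gcd_dvd1 gr0I not_le)
  then have "{a. a < n \<and> gcd a n = n} = {0}"
    using assms by auto
  then have "gcd_class n n = {res_class n 0}"
    by (simp add: gcd_class_eq_image res_class_def)
  then show ?thesis
    unfolding gens_and_zero_def gens by simp
qed

lemma verts_power_graph [simp]: "verts (power_graph A) = carrier A"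
  by (simp add: power_graph_def)

lemma dominates_power_graph_iff:
  assumes "n > 0"
  shows "u \<rightarrow>\<^bsub>power_graph (integer_mod_group n)\<^esub> v \<longleftrightarrow>
    u \<in> {0..<int n} \<and> v \<in> {0..<int n} \<and> u \<noteq> v \<and>
    (gcd u (int n) dvd gcd v (int n) \<or> gcd v (int n) dvd gcd u (int n))"
  using assms positive_multiple_iff_gcd_dvd[of n u v] positive_multiple_iff_gcd_dvd[of n v u]
  by (auto simp: power_graph_def carrier_integer_mod_group arcs_ends_def arc_to_ends_def image_iff)


section \<open>The hexagon of divisor classes\<close>

locale three_primes =
  fixes p q r n :: nat
  assumes prime_p: "prime p" and prime_q: "prime q" and prime_r: "prime r"
    and p_less_q: "p < q" and q_less_r: "q < r"
    and n_eq: "n = p * q * r"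
begin

text \<open>
  The proper nontrivial divisors of \<open>n\<close> in their cyclic order under divisibility. Reading the index
  modulo 6 allows unbounded walks around the hexagon, as \<open>connected_cycle_blowup\<close> uses them.
\<close>

definition hexagon :: "nat \<Rightarrow> nat" where
  "hexagon i = [p, p * q, q, q * r, r, p * r] ! (i mod 6)"

lemma hexagon_cases:
  obtains "i mod 6 = 0" "hexagon i = p" | "i mod 6 = 1" "hexagon i = p * q"
    | "i mod 6 = 2" "hexagon i = q" | "i mod 6 = 3" "hexagon i = q * r"
    | "i mod 6 = 4" "hexagon i = r" | "i mod 6 = 5" "hexagon i = p * r"
proof -
  have "i mod 6 < 6"
    by simp
  then have "i mod 6 = 0 \<or> i mod 6 = 1 \<or> i mod 6 = 2 \<or> i mod 6 = 3 \<or> i mod 6 = 4 \<or> i mod 6 = 5"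
    by linarith
  then show ?thesis
    using that by (auto simp: hexagon_def)
qed

lemma hexagon_period: "hexagon (i + 6) = hexagon i"
  by (simp add: hexagon_def)

lemma hexagon_join: "hexagon i dvd hexagon (Suc i) \<or> hexagon (Suc i) dvd hexagon i"
  by (rule hexagon_cases[of i]) (simp_all add: hexagon_def mod_Suc)

lemma primes_gt_1: "p > 1" "q > 1" "r > 1"
  using prime_p prime_q prime_r by (auto dest: prime_gt_1_nat)

lemma n_gt_1: "n > 1"
  unfolding n_eq by (intro less_1_mult primes_gt_1)

lemma hexagon_eq_imp_cong:
  assumes "hexagon i = hexagon j"
  shows "[i = j] (mod 6)"
proof -
  \<comment> \<open>The ordering of the primes separates all other pairs.\<close>
  have "r \<noteq> p * q"
    using prime_r primes_gt_1 prime_product[of p q] by auto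
  moreover have "p * q < p * r" "p * r < q * r" "p < p * q" "q < p * q" "r < p * r"
    using primes_gt_1 p_less_q q_less_r by simp_all
  ultimately have "distinct [p, p * q, q, q * r, r, p * r]"
    using p_less_q q_less_r by auto
  then have "i mod 6 = j mod 6"
    using assms by (auto simp: hexagon_def nth_eq_iff_index_eq)
  then show ?thesis
    by (simp add: cong_def)
qed

lemma dvd_n_cases:
  assumes "d dvd n"
  shows "d = 1 \<or> d = n \<or> d \<in> range hexagon"
proof -
  obtain a b c where "d = a * b * c" "a dvd p" "b dvd q" "c dvd r"
    using assms unfolding n_eq by (metis division_decomp)
  then have "d = a * b * c" "a = 1 \<or> a = p" "b = 1 \<or> b = q" "c = 1 \<or> c = r"
    using prime_p prime_q prime_r by (simp_all add: prime_nat_iff)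
  then have "d \<in> {1, p, q, r, p * q, p * r, q * r, n}"
    by (elim disjE) (simp_all add: n_eq)
  moreover have "p = hexagon 0" "p * q = hexagon 1" "q = hexagon 2" "q * r = hexagon 3"
    "r = hexagon 4" "p * r = hexagon 5"
    by (simp_all add: hexagon_def)
  ultimately show ?thesis
    by auto
qed

lemma hexagon_dvd_n: "hexagon i dvd n"
  by (rule hexagon_cases[of i]) (simp_all add: n_eq)

lemma hexagon_proper: "hexagon i \<noteq> 1" "hexagon i < n"
proof -
  have "1 < p * q" "1 < p * r" "1 < q * r"
    by (intro less_1_mult primes_gt_1)+
  then show "hexagon i \<noteq> 1" "hexagon i < n"
    using primes_gt_1 by (rule_tac [!] hexagon_cases[of i]) (simp_all add: n_eq)
qed

abbreviation power_gr :: "(int, int \<times> int) pre_digraph" where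
  "power_gr \<equiv> power_graph (integer_mod_group n)"

abbreviation clique :: "nat \<Rightarrow> int set" where
  "clique i \<equiv> gcd_class n (hexagon i)"

lemma hexagon_mem_clique: "int (hexagon i) \<in> clique i"
  using hexagon_proper[of i] hexagon_dvd_n[of i]
  by (simp add: gcd_class_eq_image gcd_nat.absorb1)

lemma clique_disjoint: "\<not> [i = j] (mod 6) \<Longrightarrow> clique i \<inter> clique j = {}"
  using hexagon_eq_imp_cong gcd_class_disjoint by blast

lemma
  card_clique_qr: "card (gcd_class n (q * r)) = p - 1" and
  card_clique_pr: "card (gcd_class n (p * r)) = q - 1" and
  card_clique_pq: "card (gcd_class n (p * q)) = r - 1" and
  card_clique_p: "card (gcd_class n p) = (q - 1) * (r - 1)" and
  card_clique_q: "card (gcd_class n q) = (p - 1) * (r - 1)" and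
  card_clique_r: "card (gcd_class n r) = (p - 1) * (q - 1)"
proof -
  have "coprime p q" "coprime p r" "coprime q r"
    using prime_p prime_q prime_r p_less_q q_less_r by (simp_all add: primes_coprime)
  moreover have "n div (q * r) = p" "n div (p * r) = q" "n div (p * q) = r"
    "n div p = q * r" "n div q = p * r" "n div r = p * q"
    using primes_gt_1 by (simp_all add: n_eq mult.assoc mult.left_commute[of p q])
  moreover have "q * r dvd n" "p * r dvd n" "p * q dvd n" "p dvd n" "q dvd n" "r dvd n"
    by (simp_all add: n_eq)
  ultimately show "card (gcd_class n (q * r)) = p - 1" "card (gcd_class n (p * r)) = q - 1"
    "card (gcd_class n (p * q)) = r - 1" "card (gcd_class n p) = (q - 1) * (r - 1)"
    "card (gcd_class n q) = (p - 1) * (r - 1)" "card (gcd_class n r) = (p - 1) * (q - 1)"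
    using n_gt_1 prime_p prime_q prime_r
    by (simp_all add: card_gcd_class totient_mult_coprime totient_prime)
qed

lemma card_clique_ge:
  "card (clique i) \<ge> (if [i = 3] (mod 6) then p - 1 else q - 1)"
proof -
  have "m \<le> k * m" if "k > 0" for k m :: nat
    using that by (cases k) simp_all
  from this[of "p - 1" "q - 1"] this[of "r - 1" "q - 1"] this[of "p - 1" "r - 1"]
  have "q - 1 \<le> (p - 1) * (q - 1)" "q - 1 \<le> (r - 1) * (q - 1)" "q - 1 \<le> (p - 1) * (r - 1)"
    using primes_gt_1 q_less_r by linarith+
  then show ?thesis
    using q_less_r
    by (rule_tac hexagon_cases[of i])
      (simp_all add: cong_def card_clique_qr card_clique_pr card_clique_pq card_clique_p
        card_clique_q card_clique_r mult.commute)
qed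

text \<open>
  At most one of two different cliques is the exceptional small one, \<open>[q r]\<close>.
\<close>

lemma card_two_cliques_ge:
  assumes "\<not> [i = j] (mod 6)"
  shows "card (clique i \<union> clique j) \<ge> p + q - 2"
proof -
  have "card (clique i \<union> clique j) = card (clique i) + card (clique j)"
    using clique_disjoint[OF assms] by (simp add: card_Un_disjoint)
  moreover have "\<not> ([i = 3] (mod 6) \<and> [j = 3] (mod 6))"
    using assms by (auto simp: cong_def)
  ultimately show ?thesis
    using card_clique_ge[of i] card_clique_ge[of j] p_less_q by (auto split: if_splits)
qed

lemma carrier_eq: "carrier (integer_mod_group n) = {0..<int n}"
  using n_gt_1 by (simp add: carrier_integer_mod_group)

lemma verts_reduced: "verts (reduced_power_graph n) = (\<Union>i. clique i)"
proof (intro equalityI subsetI)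
  fix x assume "x \<in> verts (reduced_power_graph n)"
  then have x: "x \<in> {0..<int n}" "x \<notin> gcd_class n 1" "x \<notin> gcd_class n n"
    using n_gt_1
    by (auto simp: reduced_power_graph_def gens_and_zero_eq_gcd_classes carrier_eq)
  then obtain k where k: "x = int k" "k < n"
    by (auto elim: nonneg_int_cases)
  then have "gcd k n \<noteq> 1" "gcd k n \<noteq> n"
    using x by (auto simp: gcd_class_def)
  then show "x \<in> (\<Union>i. clique i)"
    using dvd_n_cases[of "gcd k n"] k by (auto simp: gcd_class_def)
next
  fix x assume "x \<in> (\<Union>i. clique i)"
  then obtain i where i: "x \<in> clique i"
    by blast
  then have "x \<notin> gcd_class n 1 \<union> gcd_class n n"
    using gcd_class_disjoint[of "hexagon i" 1 n] gcd_class_disjoint[of "hexagon i" n n]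
      hexagon_proper[of i] by auto
  then show "x \<in> verts (reduced_power_graph n)"
    using i n_gt_1
    by (simp add: reduced_power_graph_def gens_and_zero_eq_gcd_classes carrier_eq)
      (simp add: gcd_class_def)
qed

lemma dominates_reduced_iff:
  "u \<rightarrow>\<^bsub>reduced_power_graph n\<^esub> v \<longleftrightarrow>
    u \<in> verts (reduced_power_graph n) \<and> v \<in> verts (reduced_power_graph n) \<and> u \<noteq> v \<and>
    (gcd u (int n) dvd gcd v (int n) \<or> gcd v (int n) dvd gcd u (int n))"
  using n_gt_1
  by (auto simp: reduced_power_graph_def dominates_delete_verts_iff dominates_power_graph_iff
      carrier_eq)

lemma dominates_cliques_iff:
  assumes "u \<in> clique i" and "v \<in> clique j"
  shows "u \<rightarrow>\<^bsub>reduced_power_graph n\<^esub> v \<longleftrightarrow>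
    u \<noteq> v \<and> (hexagon i dvd hexagon j \<or> hexagon j dvd hexagon i)"
proof -
  have "gcd u (int n) = int (hexagon i)" "gcd v (int n) = int (hexagon j)"
    using assms by (simp_all add: gcd_class_def)
  then show ?thesis
    using assms unfolding dominates_reduced_iff verts_reduced by (auto simp only: int_dvd_int_iff)
qed

lemma graph_power_gr: "graph power_gr"
  by (rule graph_power_graph) (simp add: carrier_eq)

lemma graph_reduced: "graph (reduced_power_graph n)"
  unfolding reduced_power_graph_def by (rule graph.graph_delete_verts[OF graph_power_gr])

text \<open>
  A set of fewer than \<open>p + q - 2\<close> vertices is too small to contain two different cliques, so what
  remains is a blown-up hexagon with at most one gap.
\<close>

lemma connected_reduced:
  assumes "Y \<subseteq> verts (reduced_power_graph n)" and "card Y < p + q - 2"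
  shows "Digraph_Component.connected (delete_verts (reduced_power_graph n) Y)"
proof -
  interpret R: graph "reduced_power_graph n"
    by (rule graph_reduced)
  interpret D: graph "delete_verts (reduced_power_graph n) Y"
    by (rule R.graph_delete_verts)
  have "finite Y"
    using assms(1) by (rule finite_subset) simp
  then have not_two: "[i = j] (mod 6)" if "clique i \<subseteq> Y" "clique j \<subseteq> Y" for i j
    using card_two_cliques_ge[of i j] card_mono[of Y "clique i \<union> clique j"] that assms(2)
    by fastforce
  \<comment> \<open>If no clique lies in \<open>Y\<close>, any \<open>j\<close> will do.\<close>
  obtain j where j: "\<And>i. clique i \<subseteq> Y \<Longrightarrow> [i = j] (mod 6)"
    using not_two by blast
  show ?thesis
  proof (rule D.connected_cycle_blowup[where k = 6 and C = "\<lambda>i. clique i - Y" and j = j])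
    show "verts (delete_verts (reduced_power_graph n) Y) = (\<Union>i. clique i - Y)"
      by (auto simp: verts_reduced)
    show "u \<rightarrow>\<^bsub>delete_verts (reduced_power_graph n) Y\<^esub> v"
      if "u \<in> clique i - Y" "v \<in> (clique i - Y) \<union> (clique (Suc i) - Y)" "u \<noteq> v" for i u v
    proof -
      have "u \<rightarrow>\<^bsub>reduced_power_graph n\<^esub> v"
        using that hexagon_join[of i] dominates_cliques_iff[of u i v i]
          dominates_cliques_iff[of u i v "Suc i"] by auto
      then show ?thesis
        using that by (auto simp: dominates_delete_verts_iff verts_reduced)
    qed
  qed (use j in \<open>auto simp: hexagon_period\<close>)
qed

abbreviation min_sep :: "int set" where
  "min_sep \<equiv> gcd_class n (p * r) \<union> gcd_class n (q * r)"

lemma min_sep_eq_cliques: "min_sep = clique 5 \<union> clique 3"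
  by (simp add: hexagon_def)

lemma card_min_sep: "card min_sep = p + q - 2"
proof -
  have "gcd_class n (p * r) \<inter> gcd_class n (q * r) = {}"
    using primes_gt_1 p_less_q by (intro gcd_class_disjoint) simp
  then show ?thesis
    using primes_gt_1 by (simp add: card_Un_disjoint card_clique_pr card_clique_qr)
qed

text \<open>
  The neighbours of \<open>r\<close> on the hexagon are \<open>q r\<close> and \<open>p r\<close>. Without them no edge leaves \<open>[r]\<close>, and
  \<open>[p]\<close> still has vertices outside it.
\<close>

lemma disconnected_min_sep:
  "\<not> Digraph_Component.connected (delete_verts (reduced_power_graph n) min_sep)"
proof -
  interpret R: graph "reduced_power_graph n"
    by (rule graph_reduced)
  interpret D: graph "delete_verts (reduced_power_graph n) min_sep"
    by (rule R.graph_delete_verts)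
  have r_isolated: "[i = 4] (mod 6)"
    if "\<not> [i = 5] (mod 6)" "\<not> [i = 3] (mod 6)" "hexagon i dvd r \<or> r dvd hexagon i" for i
  proof -
    have "\<not> r dvd p" "\<not> r dvd q" "\<not> p dvd r" "\<not> q dvd r" "\<not> p * q dvd r" "\<not> r dvd p * q"
      using prime_p prime_q prime_r p_less_q q_less_r
      by (auto simp: prime_dvd_mult_iff primes_dvd_imp_eq dest: primes_dvd_imp_eq dvd_mult_left)
    then show ?thesis
      using that by (rule_tac hexagon_cases[of i]) (simp_all add: cong_def)
  qed
  have not_sep: "int (hexagon i) \<notin> min_sep" if "\<not> [i = 5] (mod 6)" "\<not> [i = 3] (mod 6)" for i
    using that clique_disjoint hexagon_mem_clique[of i] unfolding min_sep_eq_cliques by blast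
  show ?thesis
  proof (rule D.disconnected_closed_set[where A = "clique 4"])
    show "int (hexagon 4) \<in> clique 4"
      by (rule hexagon_mem_clique)
    show "int (hexagon 4) \<in> verts (delete_verts (reduced_power_graph n) min_sep)"
      "int (hexagon 0) \<in> verts (delete_verts (reduced_power_graph n) min_sep)"
      using hexagon_mem_clique not_sep by (auto simp: verts_reduced cong_def)
    show "int (hexagon 0) \<notin> clique 4"
      using hexagon_mem_clique[of 0] clique_disjoint[of 0 4] by (auto simp: cong_def)
  next
    fix u v assume u: "u \<in> clique 4" and uv: "u \<rightarrow>\<^bsub>delete_verts (reduced_power_graph n) min_sep\<^esub> v"
    then obtain i where i: "v \<in> clique i"
      by (auto simp: dominates_delete_verts_iff verts_reduced)
    have "v \<notin> min_sep"
      using uv by (auto simp: dominates_delete_verts_iff)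
    then have "hexagon i \<noteq> hexagon 5" "hexagon i \<noteq> hexagon 3"
      using i unfolding min_sep_eq_cliques by auto
    then have "\<not> [i = 5] (mod 6)" "\<not> [i = 3] (mod 6)"
      by (auto simp: hexagon_def cong_def)
    moreover have "hexagon i dvd r \<or> r dvd hexagon i"
      using uv dominates_cliques_iff[OF u i]
      by (auto simp: dominates_delete_verts_iff hexagon_def[of 4])
    ultimately have "[i = 4] (mod 6)"
      by (rule r_isolated)
    then show "v \<in> clique 4"
      using i by (simp add: hexagon_def cong_def)
  qed
qed

lemma min_sep_subset: "min_sep \<subseteq> verts (reduced_power_graph n)"
  by (auto simp: min_sep_eq_cliques verts_reduced)

lemma r_remains: "int r \<in> verts (reduced_power_graph n) - min_sep"
proof -
  have "int r \<in> clique 4"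
    using hexagon_mem_clique[of 4] by (simp add: hexagon_def)
  then show ?thesis
    using clique_disjoint[of 4 5] clique_disjoint[of 4 3]
    unfolding min_sep_eq_cliques verts_reduced by (auto simp: cong_def)
qed

lemma minimum_separating_set_min_sep: "minimum_separating_set (reduced_power_graph n) min_sep"
proof -
  interpret R: graph "reduced_power_graph n"
    by (rule graph_reduced)
  have "delete_verts (reduced_power_graph n) {} = reduced_power_graph n"
    unfolding reduced_power_graph_def by (simp add: delete_verts_delete_verts)
  moreover have "p + q - 2 > 0"
    using primes_gt_1 by simp
  ultimately have conn: "Digraph_Component.connected (reduced_power_graph n)"
    using connected_reduced[of "{}"] by simp
  have "separating_set (reduced_power_graph n) min_sep"
    using R.separating_set_iff_disconnected[OF conn min_sep_subset] r_remains disconnected_min_sep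
    by blast
  moreover have "card min_sep \<le> card Y" if sep: "separating_set (reduced_power_graph n) Y" for Y
  proof (rule ccontr)
    assume "\<not> card min_sep \<le> card Y"
    then have "Digraph_Component.connected (delete_verts (reduced_power_graph n) Y)"
      using connected_reduced[of Y] sep card_min_sep by (simp add: separating_set_def)
    then have "num_components (delete_verts (reduced_power_graph n) Y) = 1"
      by (rule graph.num_components_connected[OF R.graph_delete_verts])
    then show False
      using sep R.num_components_connected[OF conn] by (simp add: separating_set_def)
  qed
  ultimately show ?thesis
    by (simp add: minimum_separating_set_def)
qed


section \<open>From the reduced graph to the power graph\<close>

lemma dominating_gens_and_zero:
  assumes "s \<in> gens_and_zero n" and "u \<in> {0..<int n}" and "u \<noteq> s"
  shows "s \<rightarrow>\<^bsub>power_gr\<^esub> u"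
proof -
  have s: "s \<in> {0..<int n}" "gcd s (int n) = 1 \<or> gcd s (int n) = int n"
    using assms(1) n_gt_1 by (auto simp: gens_and_zero_eq_gcd_classes gcd_class_def)
  then have "gcd s (int n) dvd gcd u (int n) \<or> gcd u (int n) dvd gcd s (int n)"
    by (metis gcd_dvd2 one_dvd)
  then show ?thesis
    using s(1) assms(2,3) n_gt_1 dominates_power_graph_iff[of n s u] by blast
qed

lemma gens_and_zero_subset: "gens_and_zero n \<subseteq> {0..<int n}"
  using n_gt_1 by (auto simp: gens_and_zero_eq_gcd_classes gcd_class_def)

lemma card_gens_and_zero: "card (gens_and_zero n) = totient n + 1"
proof -
  have "gcd_class n 1 \<inter> gcd_class n n = {}"
    using n_gt_1 by (intro gcd_class_disjoint) simp
  then show ?thesis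
    using n_gt_1 by (simp add: gens_and_zero_eq_gcd_classes card_Un_disjoint card_gcd_class)
qed

text \<open>
  Either a generator or \<open>0\<close> survives and is joined to everything else, or all of them are deleted and
  the remaining deletions take place in the reduced graph.
\<close>

lemma connected_power_gr:
  assumes X: "X \<subseteq> {0..<int n}" and "card X < totient n + p + q - 1"
  shows "Digraph_Component.connected (delete_verts power_gr X)"
proof (cases "gens_and_zero n \<subseteq> X")
  case True
  have fin: "finite X"
    using X by (rule finite_subset) simp
  have "card (X - gens_and_zero n) = card X - (totient n + 1)"
    using True fin by (simp add: card_Diff_subset finite_subset card_gens_and_zero)
  then have small: "card (X - gens_and_zero n) < p + q - 2"
    using assms(2) card_mono[OF fin True] primes_gt_1 by (simp add: card_gens_and_zero)
  have "X - gens_and_zero n \<subseteq> verts (reduced_power_graph n)"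
    using X by (auto simp: reduced_power_graph_def carrier_eq)
  then have "Digraph_Component.connected
      (delete_verts (reduced_power_graph n) (X - gens_and_zero n))"
    using small by (rule connected_reduced)
  moreover have "gens_and_zero n \<union> (X - gens_and_zero n) = X"
    using True by blast
  ultimately show ?thesis
    by (simp add: reduced_power_graph_def delete_verts_delete_verts)
next
  case False
  then obtain s where s: "s \<in> gens_and_zero n" "s \<notin> X"
    by blast
  interpret D: graph "delete_verts power_gr X"
    by (rule graph.graph_delete_verts[OF graph_power_gr])
  show ?thesis
    using s gens_and_zero_subset
    by (intro D.connected_dominating_vertex[of s])
      (auto simp: carrier_eq dominates_delete_verts_iff intro: dominating_gens_and_zero)
qed

lemma vertex_connectivity_power_gr: "vertex_connectivity power_gr = totient n + p + q - 1"
proof -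
  let ?X = "gens_and_zero n \<union> min_sep"
  have sub: "min_sep \<subseteq> {0..<int n}" "int r \<in> {0..<int n}" "int r \<notin> ?X"
    "gens_and_zero n \<inter> min_sep = {}"
    using min_sep_subset r_remains by (auto simp: reduced_power_graph_def carrier_eq)
  have fin: "finite ?X"
    using n_gt_1 by (simp add: gens_and_zero_eq_gcd_classes)
  then have card_X: "card ?X = totient n + p + q - 1"
    using sub(4) primes_gt_1
    by (simp add: card_Un_disjoint card_gens_and_zero card_min_sep del: Un_iff)
  \<comment> \<open>The vertex \<open>r\<close> survives, so leaving a single vertex requires at least as many deletions.\<close>
  have "?X \<subset> {0..<int n}"
    using sub gens_and_zero_subset by blast
  then have less_n: "totient n + p + q - 1 < n"
    using psubset_card_mono[of "{0..<int n}" ?X] card_X by simp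
  show ?thesis
    unfolding vertex_connectivity_def
  proof (rule Least_equality)
    have "\<not> Digraph_Component.connected (delete_verts power_gr ?X)"
      using disconnected_min_sep by (simp add: reduced_power_graph_def delete_verts_delete_verts)
    then show "\<exists>X. X \<subseteq> verts power_gr \<and> finite X \<and> card X = totient n + p + q - 1 \<and>
        (\<not> Digraph_Component.connected (delete_verts power_gr X) \<or>
          trivial_graph (delete_verts power_gr X))"
      using fin card_X sub gens_and_zero_subset by (intro exI[of _ ?X]) (simp add: carrier_eq)
  next
    fix k assume "\<exists>X. X \<subseteq> verts power_gr \<and> finite X \<and> card X = k \<and>
        (\<not> Digraph_Component.connected (delete_verts power_gr X) \<or>
          trivial_graph (delete_verts power_gr X))"
    then obtain X where X: "X \<subseteq> {0..<int n}" "finite X" "card X = k"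
      and "\<not> Digraph_Component.connected (delete_verts power_gr X) \<or>
        trivial_graph (delete_verts power_gr X)"
      by (auto simp: carrier_eq)
    then consider "\<not> Digraph_Component.connected (delete_verts power_gr X)"
      | "trivial_graph (delete_verts power_gr X)"
      by blast
    then show "totient n + p + q - 1 \<le> k"
    proof cases
      case 1
      then show ?thesis
        using connected_power_gr[OF X(1)] X(3) by fastforce
    next
      case 2
      then have "n - k = 1"
        using X by (simp add: trivial_graph_def carrier_eq card_Diff_subset)
      then show ?thesis
        using less_n by simp
    qed
  qed
qed

end

theorem theorem2p29:
  fixes n p q r :: nat
  assumes "prime p" and "prime q" and "prime r"
    and "p < q" and "q < r"
    and "n = p * q * r"
  shows "minimum_separating_set (reduced_power_graph n)
           (generator_class (integer_mod_group n) (res_class n (p * r)) \<union>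
            generator_class (integer_mod_group n) (res_class n (q * r)))
         \<and> vertex_connectivity (power_graph (integer_mod_group n)) = totient n + p + q - 1"
proof -
  interpret three_primes p q r n
    by unfold_locales (fact assms)+
  have "generator_class (integer_mod_group n) (res_class n (p * r)) = gcd_class n (p * r)"
    "generator_class (integer_mod_group n) (res_class n (q * r)) = gcd_class n (q * r)"
    using hexagon_dvd_n[of 5] hexagon_proper[of 5] hexagon_dvd_n[of 3] hexagon_proper[of 3]
    by (simp_all add: generator_class_eq_gcd_class hexagon_def)
  then show ?thesis
    using minimum_separating_set_min_sep vertex_connectivity_power_gr by simp
qed

end
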